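(* Let $(X,\xi)$ be a convergence space. (1) If $\xi$ is weakly sober and $T_D$, then every irreducible filter on $(X,\xi)$ is principal. (2) If $\xi$ is $S_0$ and $T_0$, then the converse is true, that is, $\xi$ is weakly sober and $T_D$ whenever every irreducible ultrafilter on $(X,\xi)$ is principal.
   Context: Filters on a set are proper. A convergence $\xi$ on a set $X$ assigns to each filter $\mathcal F$ on $X$ a set $\lim_\xi\mathcal F\subset X$ such that $\mathcal F\subset\mathcal G$ implies $\lim_\xi\mathcal F\subset\lim_\xi\mathcal G$, and $x\in\lim_\xi\{x\}^{\uparrow}$ for all $x\in X$, where $\{x\}^{\uparrow}=\{A\subset X:x\in A\}$. A filter is principal if it is of the form $\{F\}^{\uparrow}=\{A\subset X: F\subset A\}$ for some nonempty $F\subset X$ (so an ultrafilter is principal iff it equals $\{x\}^{\uparrow}$ for some $x\in X$). $\xi$ is $S_0$ if $x\in\lim\mathcal F$ and $t\in\lim\{x\}^{\uparrow}$ imply $t\in\lim\mathcal F$. $\xi$ is $T_0$ if for $x\neq t$ the set of filters converging to $x$ differs from the set of filters converging to $t$. $\xi$ is $T_D$ if for every $x\in X$ and every filter $\mathcal F$ with $x\in\lim\mathcal F$ there is $A\in\mathcal F$ with $\lim\{x\}^{\uparrow}\cap A\subset\{x\}$. A filter $\mathcal F$ is irreducible if $\lim_\xi\mathcal F\in\mathcal F$. $\xi$ is weakly sober if for every irreducible ultrafilter $\mathcal U$ there is a unique $x\in X$ with $\lim\mathcal U=\lim\{x\}^{\uparrow}$. *)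

theory Defs
  imports Main
begin

text \<open>
  A proper filter on a carrier \<open>X\<close> is represented by a library filter \<open>F \<noteq> bot\<close> with
  \<open>F \<le> principal X\<close>; its members are the sets \<open>A \<subseteq> X\<close> with \<open>\<forall>\<^sub>F y in F. y \<in> A\<close>.
  The library orders filters by reverse inclusion: \<open>G \<le> F\<close> means that \<open>G\<close> is finer than
  \<open>F\<close>, i.e. that every member of \<open>F\<close> is a member of \<open>G\<close>.
  The filter of all \<open>A \<subseteq> X\<close> with \<open>S \<subseteq> A\<close> is \<open>principal S\<close>.
\<close>

definition filter_on :: "'a set \<Rightarrow> 'a filter \<Rightarrow> bool" where
  "filter_on X F \<longleftrightarrow> F \<noteq> bot \<and> F \<le> principal X"

definition filter_sets :: "'a set \<Rightarrow> 'a filter \<Rightarrow> 'a set set" where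
  "filter_sets X F = {A. A \<subseteq> X \<and> (\<forall>\<^sub>F y in F. y \<in> A)}"

definition ultrafilter_on :: "'a set \<Rightarrow> 'a filter \<Rightarrow> bool" where
  "ultrafilter_on X U \<longleftrightarrow> filter_on X U \<and> (\<forall>G. filter_on X G \<and> G \<le> U \<longrightarrow> G = U)"

definition principal_filter_on :: "'a set \<Rightarrow> 'a filter \<Rightarrow> bool" where
  "principal_filter_on X F \<longleftrightarrow> (\<exists>S. S \<noteq> {} \<and> S \<subseteq> X \<and> F = principal S)"

text \<open>
  A convergence is a function \<open>L\<close> sending a filter to its set of limits. Its values
  at arguments that are not proper filters on \<open>X\<close> are arbitrary and never used.
\<close>

definition convergence_on :: "'a set \<Rightarrow> ('a filter \<Rightarrow> 'a set) \<Rightarrow> bool" where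
  "convergence_on X L \<longleftrightarrow>
     (\<forall>F. filter_on X F \<longrightarrow> L F \<subseteq> X) \<and>
     (\<forall>F G. filter_on X F \<and> filter_on X G \<and> G \<le> F \<longrightarrow> L F \<subseteq> L G) \<and>
     (\<forall>x\<in>X. x \<in> L (principal {x}))"

definition S0_convergence :: "'a set \<Rightarrow> ('a filter \<Rightarrow> 'a set) \<Rightarrow> bool" where
  "S0_convergence X L \<longleftrightarrow>
     (\<forall>F. filter_on X F \<longrightarrow>
        (\<forall>x\<in>X. \<forall>t\<in>X. x \<in> L F \<and> t \<in> L (principal {x}) \<longrightarrow> t \<in> L F))"

definition T0_convergence :: "'a set \<Rightarrow> ('a filter \<Rightarrow> 'a set) \<Rightarrow> bool" where
  "T0_convergence X L \<longleftrightarrow>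
     (\<forall>x\<in>X. \<forall>t\<in>X. x \<noteq> t \<longrightarrow>
        {F. filter_on X F \<and> x \<in> L F} \<noteq> {F. filter_on X F \<and> t \<in> L F})"

definition TD_convergence :: "'a set \<Rightarrow> ('a filter \<Rightarrow> 'a set) \<Rightarrow> bool" where
  "TD_convergence X L \<longleftrightarrow>
     (\<forall>x\<in>X. \<forall>F. filter_on X F \<and> x \<in> L F \<longrightarrow>
        (\<exists>A\<in>filter_sets X F. L (principal {x}) \<inter> A \<subseteq> {x}))"

definition irreducible_filter :: "'a set \<Rightarrow> ('a filter \<Rightarrow> 'a set) \<Rightarrow> 'a filter \<Rightarrow> bool" where
  "irreducible_filter X L F \<longleftrightarrow> filter_on X F \<and> L F \<in> filter_sets X F"

definition weakly_sober :: "'a set \<Rightarrow> ('a filter \<Rightarrow> 'a set) \<Rightarrow> bool" where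
  "weakly_sober X L \<longleftrightarrow>
     (\<forall>U. ultrafilter_on X U \<and> irreducible_filter X L U \<longrightarrow>
        (\<exists>!x. x \<in> X \<and> L U = L (principal {x})))"

end

theory Submission
  imports Defs
begin

text \<open>
  Everything is decided by the ultrafilters finer than a given filter.

  For the first part, irreducibility passes from a filter \<open>F\<close> to every finer filter, because
  limits grow while \<open>L F\<close> stays a member. So if \<open>U\<close> is an ultrafilter finer than an irreducible
  \<open>F\<close>, weak sobriety gives \<open>L U = L (principal {x})\<close>, and this set is a member of \<open>U\<close>. As
  \<open>x \<in> L U\<close>, the axiom \<open>T\<^sub>D\<close> supplies another member of \<open>U\<close> that meets it in at most \<open>x\<close>; hence
  \<open>U = principal {x}\<close>. A filter all of whose finer ultrafilters are of this form is the filter of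
  supersets of the set of these points (\<open>principal_if_finer_ultrafilters_principal\<close>).

  For the second part, \<open>S\<^sub>0\<close> and \<open>T\<^sub>0\<close> make a point \<open>x\<close> recoverable from \<open>L (principal {x})\<close>
  (\<open>S0_T0_limits_inj\<close>), which is the uniqueness in weak sobriety. If \<open>T\<^sub>D\<close> failed for a filter \<open>F\<close>
  converging to \<open>x\<close>, every member of \<open>F\<close> would meet \<open>L (principal {x}) - {x}\<close>, so some ultrafilter
  \<open>U\<close> finer than \<open>F\<close> would contain this set. By \<open>S\<^sub>0\<close>, \<open>L (principal {x}) \<subseteq> L U\<close>, so \<open>U\<close> would be
  irreducible, hence the principal ultrafilter of a point \<open>y \<noteq> x\<close> in \<open>L (principal {x})\<close>. But then
  \<open>L (principal {y}) \<subseteq> L (principal {x})\<close> by \<open>S\<^sub>0\<close>, so the two sets of limits agree and \<open>x = y\<close>.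
\<close>

lemma filter_on_principal_singleton: "x \<in> X \<Longrightarrow> filter_on X (principal {x})"
  by (simp add: filter_on_def principal_eq_bot_iff)

lemma filter_on_finer: "filter_on X F \<Longrightarrow> G \<noteq> bot \<Longrightarrow> G \<le> F \<Longrightarrow> filter_on X G"
  by (auto simp: filter_on_def)

text \<open>
  Zorn's lemma applies because the infimum of a nonempty chain of proper filters is proper: a chain
  is directed, so a set belongs to the infimum only if it belongs to one of the filters.
\<close>
lemma exists_finer_ultrafilter:
  assumes F: "filter_on X F"
  obtains U where "ultrafilter_on X U" "U \<le> F"
proof -
  define A where "A = {G. G \<noteq> bot \<and> G \<le> F}"
  define P where "P = (\<lambda>G H :: 'a filter. H \<le> G)"
  have FA: "F \<in> A"
    using F by (simp add: A_def filter_on_def)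
  have "\<exists>m\<in>A. \<forall>a\<in>A. P m a \<longrightarrow> a = m"
  proof (rule predicate_Zorn)
    show "partial_order_on A (relation_of P A)"
      by (rule partial_order_on_relation_ofI) (auto simp: P_def)
  next
    fix C assume C: "C \<in> Chains (relation_of P A)"
    have sub: "C \<subseteq> A"
      using C by (auto simp: Chains_def relation_of_def)
    show "\<exists>u\<in>A. \<forall>a\<in>C. P a u"
    proof (cases "C = {}")
      case True
      then show ?thesis using FA by blast
    next
      case False
      have "\<exists>x\<in>C. x \<le> inf G H" if "G \<in> C" "H \<in> C" for G H
      proof -
        have "G \<le> H \<or> H \<le> G"
          using C that by (auto simp: Chains_def relation_of_def P_def)
        then show ?thesis
          using that by (auto simp: inf_absorb1 inf_absorb2)
      qed
      then have "eventually (\<lambda>_. False) (Inf C) \<longleftrightarrow> (\<exists>b\<in>C. eventually (\<lambda>_. False) b)"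
        using False by (intro eventually_Inf_base)
      then have "Inf C \<noteq> bot"
        using sub by (auto simp: A_def eventually_False)
      moreover obtain c where "c \<in> C"
        using False by blast
      then have "Inf C \<le> F"
        using sub by (auto simp: A_def intro: order_trans[OF Inf_lower])
      ultimately have "Inf C \<in> A"
        by (simp add: A_def)
      then show ?thesis
        by (auto simp: P_def intro: Inf_lower)
    qed
  qed
  then obtain U where U: "U \<in> A" "\<And>G. G \<in> A \<Longrightarrow> G \<le> U \<Longrightarrow> G = U"
    by (auto simp: P_def)
  have "ultrafilter_on X U"
    unfolding ultrafilter_on_def
    using U filter_on_finer[OF F] by (auto simp: A_def filter_on_def)
  then show thesis
    using U(1) that by (auto simp: A_def)
qed

text \<open>A set that meets every member of a filter can be adjoined to it without losing properness.\<close>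
lemma exists_finer_ultrafilter_containing:
  assumes "filter_on X F" "\<not> (\<forall>\<^sub>F y in F. y \<notin> S)"
  obtains U where "ultrafilter_on X U" "U \<le> F" "\<forall>\<^sub>F y in U. y \<in> S"
proof -
  have "inf F (principal S) \<noteq> bot"
    using assms(2) by (simp add: eventually_inf_principal flip: eventually_False)
  then have "filter_on X (inf F (principal S))"
    by (rule filter_on_finer[OF assms(1)]) simp
  then obtain U where "ultrafilter_on X U" "U \<le> inf F (principal S)"
    by (rule exists_finer_ultrafilter)
  then show thesis
    using that by (auto simp: le_principal)
qed

lemma proper_le_principal_singleton:
  assumes "U \<noteq> bot" "U \<le> principal {x}"
  shows "U = principal {x}"
proof (rule antisym)
  show "principal {x} \<le> U"
  proof (rule filter_leI)
    fix P assume "eventually P U"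
    moreover have "\<forall>\<^sub>F y in U. y = x"
      using assms(2) by (simp add: le_principal)
    ultimately have "\<forall>\<^sub>F y in U. P x"
      by eventually_elim simp
    then show "eventually P (principal {x})"
      using assms(1) by (cases "P x") (auto simp: eventually_principal eventually_False)
  qed
qed (fact assms(2))

lemma principal_ultrafilter_is_point_filter:
  assumes "ultrafilter_on X U" "principal_filter_on X U"
  obtains x where "x \<in> X" "U = principal {x}"
proof -
  obtain S x where S: "S \<subseteq> X" "U = principal S" "x \<in> S"
    using assms(2) by (auto simp: principal_filter_on_def)
  then have "principal {x} = U"
    using assms(1) filter_on_principal_singleton[of x X] by (auto simp: ultrafilter_on_def)
  then show thesis
    using that S by blast
qed

text \<open>
  The only candidate for the generating set consists of the points whose point filter is finer
  than \<open>F\<close>. It is a member of \<open>F\<close>: otherwise some ultrafilter finer than \<open>F\<close> would contain its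
  complement, and this ultrafilter could not be the point filter of any such point.
\<close>
lemma principal_if_finer_ultrafilters_principal:
  assumes F: "filter_on X F"
    and points: "\<And>U. ultrafilter_on X U \<Longrightarrow> U \<le> F \<Longrightarrow> \<exists>x. U = principal {x}"
  shows "principal_filter_on X F"
proof -
  define S where "S = {x. principal {x} \<le> F}"
  have "\<forall>\<^sub>F y in F. y \<notin> - S"
  proof (rule ccontr)
    assume "\<not> (\<forall>\<^sub>F y in F. y \<notin> - S)"
    then obtain U where U: "ultrafilter_on X U" "U \<le> F" "\<forall>\<^sub>F y in U. y \<in> - S"
      using exists_finer_ultrafilter_containing[OF F] by blast
    then obtain x where "U = principal {x}"
      using points by blast
    then show False
      using U by (auto simp: S_def eventually_principal)
  qed
  then have "F \<le> principal S"
    by (simp add: le_principal)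
  moreover have "principal S \<le> F"
    by (rule filter_leI) (auto simp: S_def le_filter_def eventually_principal)
  ultimately have eq: "F = principal S"
    by (rule antisym)
  then have "S \<noteq> {}" "S \<subseteq> X"
    using F by (auto simp: filter_on_def principal_eq_bot_iff)
  then show ?thesis
    using eq by (auto simp: principal_filter_on_def)
qed

lemma irreducible_finer:
  assumes "convergence_on X L" "irreducible_filter X L F" "filter_on X G" "G \<le> F"
  shows "irreducible_filter X L G"
proof -
  have "L F \<subseteq> L G" "L G \<subseteq> X"
    using assms by (auto simp: convergence_on_def irreducible_filter_def)
  moreover have "\<forall>\<^sub>F y in G. y \<in> L F"
    using assms by (auto simp: irreducible_filter_def filter_sets_def le_filter_def)
  ultimately show ?thesis
    using assms(3) by (auto simp: irreducible_filter_def filter_sets_def elim: eventually_mono)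
qed

text \<open>
  Each of the two points is a limit of the other's point filter, so by \<open>S\<^sub>0\<close> every filter that
  converges to one of them converges to the other.
\<close>
lemma S0_T0_limits_inj:
  assumes "convergence_on X L" "S0_convergence X L" "T0_convergence X L"
    and "x \<in> X" "y \<in> X" "L (principal {x}) = L (principal {y})"
  shows "x = y"
proof (rule ccontr)
  assume "x \<noteq> y"
  have "y \<in> L (principal {x})" "x \<in> L (principal {y})"
    using assms by (auto simp: convergence_on_def)
  then have "{F. filter_on X F \<and> x \<in> L F} = {F. filter_on X F \<and> y \<in> L F}"
    using assms(2,4,5) unfolding S0_convergence_def by blast
  then show False
    using assms(3-5) \<open>x \<noteq> y\<close> by (auto simp: T0_convergence_def)
qed

lemma S0_limits_subset:
  assumes "convergence_on X L" "S0_convergence X L" "filter_on X F" "x \<in> X" "x \<in> L F"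
  shows "L (principal {x}) \<subseteq> L F"
proof -
  have "L (principal {x}) \<subseteq> X"
    using assms(1,4) by (simp add: convergence_on_def filter_on_principal_singleton)
  then show ?thesis
    using assms unfolding S0_convergence_def by blast
qed

lemma weakly_sober_TD_irreducible_ultrafilter_point:
  assumes L: "convergence_on X L" and "weakly_sober X L" and TD: "TD_convergence X L"
    and U: "ultrafilter_on X U" "irreducible_filter X L U"
  shows "\<exists>x. U = principal {x}"
proof -
  have fU: "filter_on X U"
    using U(1) by (simp add: ultrafilter_on_def)
  obtain x where x: "x \<in> X" "L U = L (principal {x})"
    using assms by (auto simp: weakly_sober_def)
  then have "x \<in> L U"
    using L by (simp add: convergence_on_def)
  then obtain A where A: "A \<in> filter_sets X U" "L (principal {x}) \<inter> A \<subseteq> {x}"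
    using TD x(1) fU unfolding TD_convergence_def by blast
  have "\<forall>\<^sub>F y in U. y \<in> A" "\<forall>\<^sub>F y in U. y \<in> L (principal {x})"
    using A(1) U(2) x(2) by (auto simp: filter_sets_def irreducible_filter_def)
  then have "\<forall>\<^sub>F y in U. y \<in> {x}"
    by eventually_elim (use A(2) in blast)
  then have "U = principal {x}"
    using fU by (intro proper_le_principal_singleton) (simp_all add: le_principal filter_on_def)
  then show ?thesis ..
qed

theorem irreducible_filter_principal:
  assumes L: "convergence_on X L" and "weakly_sober X L" "TD_convergence X L"
    and F: "irreducible_filter X L F"
  shows "principal_filter_on X F"
proof (rule principal_if_finer_ultrafilters_principal)
  show "filter_on X F"
    using F by (simp add: irreducible_filter_def)
next
  fix U assume U: "ultrafilter_on X U" "U \<le> F"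
  then have "irreducible_filter X L U"
    using irreducible_finer[OF L F] by (simp add: ultrafilter_on_def)
  then show "\<exists>x. U = principal {x}"
    using weakly_sober_TD_irreducible_ultrafilter_point assms U(1) by blast
qed

lemma weakly_sober_if_irreducible_ultrafilters_principal:
  assumes L: "convergence_on X L" "S0_convergence X L" "T0_convergence X L"
    and "\<And>U. ultrafilter_on X U \<Longrightarrow> irreducible_filter X L U \<Longrightarrow> principal_filter_on X U"
  shows "weakly_sober X L"
  unfolding weakly_sober_def
proof (intro allI impI, elim conjE)
  fix U assume U: "ultrafilter_on X U" "irreducible_filter X L U"
  then obtain x where "x \<in> X" "U = principal {x}"
    using assms(4) principal_ultrafilter_is_point_filter by blast
  then show "\<exists>!x. x \<in> X \<and> L U = L (principal {x})"
    using S0_T0_limits_inj[OF L] by blast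
qed

lemma TD_if_irreducible_ultrafilters_principal:
  assumes L: "convergence_on X L" "S0_convergence X L" "T0_convergence X L"
    and principal: "\<And>U. ultrafilter_on X U \<Longrightarrow> irreducible_filter X L U \<Longrightarrow> principal_filter_on X U"
  shows "TD_convergence X L"
  unfolding TD_convergence_def
proof (intro ballI allI impI, elim conjE)
  fix x F assume x: "x \<in> X" and F: "filter_on X F" "x \<in> L F"
  define S where "S = L (principal {x}) - {x}"
  have "\<forall>\<^sub>F y in F. y \<notin> S"
  proof (rule ccontr)
    assume "\<not> (\<forall>\<^sub>F y in F. y \<notin> S)"
    then obtain U where U: "ultrafilter_on X U" "U \<le> F" and S: "\<forall>\<^sub>F y in U. y \<in> S"
      using exists_finer_ultrafilter_containing[OF F(1)] by blast
    have fU: "filter_on X U"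
      using U(1) by (simp add: ultrafilter_on_def)
    have LU: "L U \<subseteq> X" "x \<in> L U"
      using L(1) F U(2) fU unfolding convergence_on_def by blast+
    have sub: "L (principal {x}) \<subseteq> L U"
      using S0_limits_subset[OF L(1,2) fU x LU(2)] .
    have "\<forall>\<^sub>F y in U. y \<in> L U"
      using S by eventually_elim (use sub in \<open>auto simp: S_def\<close>)
    then have "irreducible_filter X L U"
      using fU LU(1) by (simp add: irreducible_filter_def filter_sets_def)
    then obtain y where y: "y \<in> X" "U = principal {y}"
      using principal[OF U(1)] principal_ultrafilter_is_point_filter[OF U(1)] by blast
    then have yS: "y \<in> L (principal {x})" "y \<noteq> x"
      using S by (auto simp: S_def eventually_principal)
    have "L (principal {y}) \<subseteq> L (principal {x})"
      using S0_limits_subset[OF L(1,2) filter_on_principal_singleton[OF x] y(1) yS(1)] .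
    then show False
      using S0_T0_limits_inj[OF L y(1) x] sub y(2) yS(2) by blast
  qed
  moreover have "\<forall>\<^sub>F y in F. y \<in> X"
    using F(1) by (simp add: filter_on_def le_principal)
  ultimately have "\<forall>\<^sub>F y in F. y \<in> X - S"
    by eventually_elim simp
  then show "\<exists>A\<in>filter_sets X F. L (principal {x}) \<inter> A \<subseteq> {x}"
    by (intro bexI[of _ "X - S"]) (auto simp: filter_sets_def S_def)
qed

theorem theorem46:
  fixes X :: "'a set" and L :: "'a filter \<Rightarrow> 'a set"
  assumes "convergence_on X L"
  shows "(weakly_sober X L \<and> TD_convergence X L \<longrightarrow>
            (\<forall>F. irreducible_filter X L F \<longrightarrow> principal_filter_on X F)) \<and>
         (S0_convergence X L \<and> T0_convergence X L \<longrightarrow>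
            (\<forall>U. ultrafilter_on X U \<and> irreducible_filter X L U \<longrightarrow> principal_filter_on X U) \<longrightarrow>
            weakly_sober X L \<and> TD_convergence X L)"
  using assms irreducible_filter_principal weakly_sober_if_irreducible_ultrafilters_principal
    TD_if_irreducible_ultrafilters_principal
  by blast

end
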